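(* Let $B=\{0,1\}^{\{0,1,2,\dots\}}$, let $R:B\to B$ be the one-sided shift $R(x_0,x_1,x_2,\dots)=(x_1,x_2,x_3,\dots)$, and let $F:B\times\{0,1\}\to B\times\{0,1\}$ be given by $F(x,y)=(R(x),x_0)$ for $x=(x_0,x_1,\dots)$. Then there exists a function $\phi:B\to\{0,1\}$ whose graph is an attractor of $F$ with basin of attraction equal to the whole space $B\times\{0,1\}$.
   Context: Let $\pi_2(x,y)=y$. The basin of attraction of the graph of $\phi:B\to\{0,1\}$ is the set of all $(x,y)\in B\times\{0,1\}$ for which there is $N$ such that $\pi_2(F^n(x,y))=\phi(R^n(x))$ for every $n\ge N$. The graph of $\phi$ is an attractor with basin equal to the whole space if and only if for every $(x,y)\in B\times\{0,1\}$ there is such an $N$. *)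

theory Defs
  imports Main "HOL-Library.Z2"
begin

text \<open>
  The set \<open>{0, 1}\<close> is the two-element type \<^typ>\<open>bit\<close>; its field structure is not used.
\<close>

type_synonym base = "nat \<Rightarrow> bit"

definition R :: "base \<Rightarrow> base" where
  "R x = (\<lambda>n. x (Suc n))"

definition F :: "base \<times> bit \<Rightarrow> base \<times> bit" where
  "F = (\<lambda>(x, y). (R x, x 0))"

text \<open>
  The points whose fibre coordinate eventually coincides with the graph of \<open>\<phi>\<close>
  over the moving base point. The graph of \<open>\<phi>\<close> is an attractor with basin the whole
  space exactly when this set is \<^term>\<open>UNIV\<close>; no continuity or measurability of \<open>\<phi>\<close>
  and no invariance of its graph is asked for.
\<close>

definition basin_of_graph :: "(base \<Rightarrow> bit) \<Rightarrow> (base \<times> bit) set" where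
  "basin_of_graph \<phi> =
    {(x, y). \<exists>N. \<forall>n\<ge>N. snd ((F ^^ n) (x, y)) = \<phi> ((R ^^ n) x)}"

end

theory Submission imports Defs begin

text \<open>
  For \<open>n \<ge> 1\<close> the fibre coordinate of \<open>F\<^sup>n (x, y)\<close> is \<open>x\<^sub>n\<^sub>-\<^sub>1\<close>, so \<open>\<phi>\<close> has to recover, from
  \<open>R\<^sup>n x\<close>, the digit deleted last. Call two sequences equivalent if their forward orbits meet, and
  choose in each class a point \<open>z\<close> on whose forward orbit \<open>R\<close> is injective (a periodic point, or
  any point if the class contains no periodic one). On the orbit of \<open>z\<close>, let \<open>\<phi>\<close> return the first
  digit of the unique preimage inside that orbit. The orbit of every point of the class eventually
  runs along the orbit of \<open>z\<close>, and from then on the prediction is correct.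
\<close>

definition orbits_meet :: "('a \<Rightarrow> 'a) \<Rightarrow> 'a \<Rightarrow> 'a \<Rightarrow> bool" where
  "orbits_meet f x z \<longleftrightarrow> (\<exists>m n. (f ^^ m) x = (f ^^ n) z)"

definition inj_on_orbit :: "('a \<Rightarrow> 'a) \<Rightarrow> 'a \<Rightarrow> bool" where
  "inj_on_orbit f z \<longleftrightarrow> (\<forall>m n. (f ^^ Suc m) z = (f ^^ Suc n) z \<longrightarrow> (f ^^ m) z = (f ^^ n) z)"

definition orbit_rep :: "('a \<Rightarrow> 'a) \<Rightarrow> 'a \<Rightarrow> 'a" where
  "orbit_rep f x = (SOME z. orbits_meet f x z \<and> inj_on_orbit f z)"

lemma inj_on_orbit_periodic:
  assumes "(f ^^ Suc p) z = z"
  shows "inj_on_orbit f z"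
  unfolding inj_on_orbit_def
proof (intro allI impI)
  fix m n
  assume eq: "(f ^^ Suc m) z = (f ^^ Suc n) z"
  \<comment> \<open>On the cycle through \<open>z\<close>, \<open>f ^^ p\<close> is a left inverse
    of \<open>f\<close>.\<close>
  have return: "(f ^^ p) ((f ^^ Suc k) z) = (f ^^ k) z" for k
  proof -
    have "(f ^^ p) ((f ^^ Suc k) z) = (f ^^ (p + Suc k)) z"
      by (simp only: funpow_add comp_apply)
    also have "\<dots> = (f ^^ (k + Suc p)) z"
      by (simp only: add_Suc_right add.commute)
    also have "\<dots> = (f ^^ k) z"
      by (simp only: funpow_add comp_apply assms)
    finally show ?thesis .
  qed
  from eq have "(f ^^ p) ((f ^^ Suc m) z) = (f ^^ p) ((f ^^ Suc n) z)"
    by (rule arg_cong)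
  then show "(f ^^ m) z = (f ^^ n) z"
    by (simp only: return)
qed

lemma ex_inj_on_orbit: "\<exists>z. orbits_meet f x z \<and> inj_on_orbit f z"
proof (cases "inj (\<lambda>n. (f ^^ n) x)")
  case True
  then have "inj_on_orbit f x"
    unfolding inj_on_orbit_def by (auto dest!: injD simp del: funpow.simps)
  then show ?thesis
    unfolding orbits_meet_def by blast
next
  case False
  \<comment> \<open>A repetition at times \<open>m < n\<close> makes \<open>(f ^^ m) x\<close>
    periodic with period \<open>n - m\<close>.\<close>
  then obtain m n where "m < n" and eq: "(f ^^ m) x = (f ^^ n) x"
    unfolding inj_def by (metis nat_neq_iff)
  then obtain p where "n = Suc p + m"
    using less_imp_Suc_add[of m n] by auto
  with eq have "(f ^^ Suc p) ((f ^^ m) x) = (f ^^ m) x"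
    by (simp only: funpow_add comp_apply)
  then have "inj_on_orbit f ((f ^^ m) x)"
    by (rule inj_on_orbit_periodic)
  moreover have "orbits_meet f x ((f ^^ m) x)"
    unfolding orbits_meet_def by (metis funpow_0)
  ultimately show ?thesis
    by blast
qed

lemma orbit_rep_meets: "orbits_meet f x (orbit_rep f x)"
  and orbit_rep_inj: "inj_on_orbit f (orbit_rep f x)"
  using someI_ex[OF ex_inj_on_orbit[of f x]] by (simp_all add: orbit_rep_def)

lemma orbits_meet_step: "orbits_meet f (f x) z \<longleftrightarrow> orbits_meet f x z"
proof
  assume "orbits_meet f (f x) z"
  then show "orbits_meet f x z"
    unfolding orbits_meet_def by (metis comp_apply funpow_Suc_right)
next
  assume "orbits_meet f x z"
  then obtain m n where "(f ^^ m) x = (f ^^ n) z"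
    unfolding orbits_meet_def by blast
  then have "(f ^^ m) (f x) = (f ^^ Suc n) z"
    by (simp flip: funpow_swap1)
  then show "orbits_meet f (f x) z"
    unfolding orbits_meet_def by blast
qed

text \<open>Points of one orbit meet the same orbits, so \<open>SOME\<close> is applied to one and
  the same predicate.\<close>

lemma orbit_rep_funpow: "orbit_rep f ((f ^^ n) x) = orbit_rep f x"
  by (induction n) (simp_all add: orbit_rep_def orbits_meet_step)

lemma R_funpow: "(R ^^ n) x k = x (n + k)"
  by (induction n arbitrary: k) (simp_all add: R_def)

lemma F_funpow_Suc: "(F ^^ Suc n) (x, y) = ((R ^^ Suc n) x, x n)"
proof (induction n)
  case 0
  show ?case
    by (simp add: F_def)
next
  case (Suc n)
  have "(F ^^ Suc (Suc n)) (x, y) = F ((R ^^ Suc n) x, x n)"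
    using Suc.IH by simp
  also have "\<dots> = ((R ^^ Suc (Suc n)) x, x (Suc n))"
    using R_funpow[of "Suc n" x 0] by (simp add: F_def)
  finally show ?case .
qed

text \<open>If no such \<open>k\<close> exists the value is arbitrary; along any orbit this happens
  at only finitely many times.\<close>

definition last_digit :: "base \<Rightarrow> bit" where
  "last_digit w = (let z = orbit_rep R w in z (SOME k. (R ^^ Suc k) z = w))"

lemma last_digit_orbit_rep:
  assumes "orbit_rep R w = z" "(R ^^ Suc k) z = w"
  shows "last_digit w = z k"
proof -
  define l where "l = (SOME l. (R ^^ Suc l) z = w)"
  \<comment> \<open>On a periodic orbit the chosen index \<open>l\<close> may differ from
    \<open>k\<close>, but injectivity gives the same preimage and hence the same first
    digit.\<close>
  have "(R ^^ Suc l) z = (R ^^ Suc k) z"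
    unfolding l_def assms(2) by (rule someI[where x = k]) (rule assms(2))
  with orbit_rep_inj[of R w] have "(R ^^ l) z = (R ^^ k) z"
    unfolding inj_on_orbit_def assms(1) by blast
  then have "z l = z k"
    using R_funpow[of l z 0] R_funpow[of k z 0] by simp
  then show ?thesis
    by (simp add: last_digit_def assms(1) Let_def l_def)
qed

lemma last_digit_eventually: "\<exists>N. \<forall>n\<ge>N. last_digit ((R ^^ Suc n) x) = x n"
proof -
  define z where "z = orbit_rep R x"
  obtain a b where ab: "(R ^^ a) x = (R ^^ b) z"
    using orbit_rep_meets[of R x] unfolding orbits_meet_def z_def by blast
  have "last_digit ((R ^^ Suc n) x) = x n" if n_ge: "n \<ge> a" for n
  proof -
    obtain d where n: "n = d + a"
      using le_Suc_ex[OF n_ge] by (auto simp: add.commute)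
    have shifted: "(R ^^ (d + b)) z = (R ^^ n) x"
      by (simp add: n funpow_add ab)
    then have "(R ^^ Suc (d + b)) z = (R ^^ Suc n) x"
      by simp
    then have "last_digit ((R ^^ Suc n) x) = z (d + b)"
      by (rule last_digit_orbit_rep[rotated]) (simp only: orbit_rep_funpow z_def)
    also have "\<dots> = x n"
      using R_funpow[of "d + b" z 0] R_funpow[of n x 0] shifted by simp
    finally show ?thesis .
  qed
  then show ?thesis
    by blast
qed

theorem theorem3p2:
  "\<exists>\<phi> :: base \<Rightarrow> bit. basin_of_graph \<phi> = UNIV"
proof -
  have "(x, y) \<in> basin_of_graph last_digit" for x y
  proof -
    obtain N where N: "\<And>n. n \<ge> N \<Longrightarrow> last_digit ((R ^^ Suc n) x) = x n"
      using last_digit_eventually[of x] by blast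
    \<comment> \<open>The bound is \<open>Suc N\<close> because at time 0 the fibre coordinate is
      still the arbitrary \<open>y\<close>.\<close>
    have "snd ((F ^^ n) (x, y)) = last_digit ((R ^^ n) x)" if n: "n \<ge> Suc N" for n
    proof -
      obtain k where "n = Suc k" "k \<ge> N"
        using n by (cases n) auto
      then show ?thesis
        by (simp only: F_funpow_Suc snd_conv N)
    qed
    then show ?thesis
      unfolding basin_of_graph_def by blast
  qed
  then have "basin_of_graph last_digit = UNIV"
    by auto
  then show ?thesis
    by blast
qed

end
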